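(* Suppose that $G$ is a graph with $\operatorname{Z}(G)=r$ for some $r\ge 2$. Let $B$ and $B'$ be two disjoint minimum zero forcing sets of $G$ that are reversals of each other and for which there is no minimum zero forcing set in $G$ that intersects both $B$ and $B'$. Let $\widetilde{G}$ be the graph of order $|V(G)|+2r$ obtained from $G$ by adding $r$ new leaves $a_1,\dots,a_r$ to $B$ and $r$ new leaves $a_1',\dots,a_r'$ to $B'$, with exactly one new leaf adjacent to each vertex of $B$ and of $B'$. Then $\operatorname{Z}(\widetilde{G})=r$ and $\mathscr{Z}(\widetilde{G})$ is disconnected.
   Context: All graphs are finite, simple and undirected. Zero forcing: vertices of a graph $G$ are colored blue or white; the color change rule says that a blue vertex $u$ can change the color of a white vertex $w$ to blue if $w$ is the unique white neighbor of $u$ (we say $u$ forces $w$). A set $B\subseteq V(G)$ is a zero forcing set of $G$ if, starting with exactly the vertices of $B$ blue and applying the color change rule repeatedly, all vertices eventually become blue. The zero forcing number $\operatorname{Z}(G)$ is the minimum of $|B|$ over all zero forcing sets $B$ of $G$; a minimum zero forcing set is a zero forcing set $B$ with $|B|=\operatorname{Z}(G)$. The zero forcing graph $\mathscr{Z}(G)$ is the graph whose vertices are the minimum zero forcing sets of $G$, with two of them adjacent if and only if their symmetric difference has exactly two elements. A chronological list of forces of a zero forcing set $B$ is an ordered list of forces which, performed one at a time starting with exactly $B$ blue, colors all vertices blue. A reversal of $B$ is the set of vertices that do not perform a force in some chronological list of forces of $B$ (a zero forcing set may have more than one reversal). $B$ and $B'$ are reversals of each other if each is a reversal of the other. A leaf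 is a vertex of degree one. *)

theory Defs
  imports "Graph_Theory.Digraph_Component"
begin

text \<open>
  A finite simple undirected graph is a \<^const>\<open>pair_graph\<close>: an undirected edge between
  \<open>u\<close> and \<open>v\<close> is the pair of opposite arcs \<open>(u, v)\<close> and \<open>(v, u)\<close>.
\<close>

definition neighbors :: "'a pair_pre_digraph \<Rightarrow> 'a \<Rightarrow> 'a set" where
  "neighbors G u = {w. (u, w) \<in> parcs G}"

text \<open>Throughout, a coloring is given by its set \<open>S\<close> of blue vertices.\<close>

definition can_force :: "'a pair_pre_digraph \<Rightarrow> 'a set \<Rightarrow> 'a \<Rightarrow> 'a \<Rightarrow> bool" where
  "can_force G S u w \<longleftrightarrow> u \<in> S \<and> neighbors G u - S = {w}"

definition color_change :: "'a pair_pre_digraph \<Rightarrow> 'a set \<Rightarrow> 'a set \<Rightarrow> bool" where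
  "color_change G S S' \<longleftrightarrow> (\<exists>u w. can_force G S u w \<and> S' = insert w S)"

definition zero_forcing_set :: "'a pair_pre_digraph \<Rightarrow> 'a set \<Rightarrow> bool" where
  "zero_forcing_set G B \<longleftrightarrow> B \<subseteq> pverts G \<and> (color_change G)\<^sup>*\<^sup>* B (pverts G)"

definition zero_forcing_number :: "'a pair_pre_digraph \<Rightarrow> nat" where
  "zero_forcing_number G = (LEAST n. \<exists>B. zero_forcing_set G B \<and> card B = n)"

definition min_zero_forcing_set :: "'a pair_pre_digraph \<Rightarrow> 'a set \<Rightarrow> bool" where
  "min_zero_forcing_set G B \<longleftrightarrow> zero_forcing_set G B \<and> card B = zero_forcing_number G"

definition zero_forcing_graph :: "'a pair_pre_digraph \<Rightarrow> 'a set pair_pre_digraph" where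
  "zero_forcing_graph G =
    \<lparr> pverts = {B. min_zero_forcing_set G B},
      parcs = {(B, B'). min_zero_forcing_set G B \<and> min_zero_forcing_set G B' \<and>
                        card ((B - B') \<union> (B' - B)) = 2} \<rparr>"

text \<open>A list entry \<open>(u, w)\<close> stands for the force of \<open>w\<close> by \<open>u\<close>.\<close>

fun chronological_list :: "'a pair_pre_digraph \<Rightarrow> 'a set \<Rightarrow> ('a \<times> 'a) list \<Rightarrow> bool" where
  "chronological_list G S [] \<longleftrightarrow> S = pverts G"
| "chronological_list G S ((u, w) # fs) \<longleftrightarrow>
     can_force G S u w \<and> chronological_list G (insert w S) fs"

definition is_reversal :: "'a pair_pre_digraph \<Rightarrow> 'a set \<Rightarrow> 'a set \<Rightarrow> bool" where
  "is_reversal G B R \<longleftrightarrow> (\<exists>fs. chronological_list G B fs \<and> R = pverts G - fst ` set fs)"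

text \<open>
  One new leaf is attached to each vertex of \<open>U\<close>. The vertices of \<open>G\<close> reappear as \<open>Inl v\<close>, and
  \<open>Inr v\<close> is the new leaf at \<open>v\<close>.
\<close>

definition attach_leaves :: "'a pair_pre_digraph \<Rightarrow> 'a set \<Rightarrow> ('a + 'a) pair_pre_digraph" where
  "attach_leaves G U =
    \<lparr> pverts = Inl ` pverts G \<union> Inr ` U,
      parcs = {(Inl u, Inl v) | u v. (u, v) \<in> parcs G}
            \<union> {(Inl v, Inr v) | v. v \<in> U} \<union> {(Inr v, Inl v) | v. v \<in> U} \<rparr>"

lemma pair_graph_attach_leaves:
  assumes "pair_graph G" "U \<subseteq> pverts G"
  shows "pair_graph (attach_leaves G U)"
proof -
  interpret pair_graph G by fact
  have fin: "finite (pverts (attach_leaves G U))"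
    using finite_subset[OF assms(2) pair_finite_verts] pair_finite_verts
    by (simp add: attach_leaves_def)
  have wf: "parcs (attach_leaves G U) \<subseteq> pverts (attach_leaves G U) \<times> pverts (attach_leaves G U)"
    using assms(2) by (auto simp: attach_leaves_def dest: in_arcsD1 in_arcsD2)
  have "finite (parcs (attach_leaves G U))"
    using wf fin by (meson finite_SigmaI finite_subset)
  moreover have "sym (parcs (attach_leaves G U))"
    using pair_sym_arcs by (auto simp: attach_leaves_def symmetric_def sym_def)
  moreover have "\<forall>e \<in> parcs (attach_leaves G U). fst e \<noteq> snd e"
    using pair_no_loops by (fastforce simp: attach_leaves_def)
  ultimately show ?thesis
    using fin wf by unfold_locales (auto simp: symmetric_def)
qed

lemma card_verts_attach_leaves:
  assumes "finite (pverts G)" "finite U"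
  shows "card (pverts (attach_leaves G U)) = card (pverts G) + card U"
  using assms by (subst attach_leaves_def, simp, subst card_Un_disjoint)
    (auto simp: card_image)

lemma neighbors_new_leaf: "v \<in> U \<Longrightarrow> neighbors (attach_leaves G U) (Inr v) = {Inl v}"
  by (auto simp: neighbors_def attach_leaves_def)

lemma pair_graph_zero_forcing_graph:
  assumes "pair_graph G"
  shows "pair_graph (zero_forcing_graph G)"
proof -
  interpret pair_graph G by fact
  have fin: "finite (pverts (zero_forcing_graph G))"
    using pair_finite_verts
    by (auto simp: zero_forcing_graph_def min_zero_forcing_set_def zero_forcing_set_def
             intro: finite_subset[where B = "Pow (pverts G)"])
  have wf: "parcs (zero_forcing_graph G)
              \<subseteq> pverts (zero_forcing_graph G) \<times> pverts (zero_forcing_graph G)"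
    by (auto simp: zero_forcing_graph_def)
  have "finite (parcs (zero_forcing_graph G))"
    using wf fin by (meson finite_SigmaI finite_subset)
  moreover have "sym (parcs (zero_forcing_graph G))"
    by (auto simp: zero_forcing_graph_def sym_def Un_commute)
  moreover have "\<forall>e \<in> parcs (zero_forcing_graph G). fst e \<noteq> snd e"
    by (auto simp: zero_forcing_graph_def)
  ultimately show ?thesis
    using fin wf by unfold_locales (auto simp: symmetric_def)
qed

text \<open>
  The library's \<^const>\<open>connected\<close> is false for the graph without vertices; the next lemma
  shows that this case never arises for a zero forcing graph.
\<close>

lemma zero_forcing_graph_nonempty: "pverts (zero_forcing_graph G) \<noteq> {}"
proof -
  have "\<exists>B. zero_forcing_set G B \<and> card B = card (pverts G)"
    by (auto simp: zero_forcing_set_def intro: exI[where x = "pverts G"])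
  then have "\<exists>B. zero_forcing_set G B \<and> card B = zero_forcing_number G"
    unfolding zero_forcing_number_def by (rule LeastI)
  then show ?thesis
    by (auto simp: zero_forcing_graph_def min_zero_forcing_set_def)
qed

end

theory Submission
  imports Defs
begin

text \<open>
  Contracting every new leaf onto its neighbor turns a zero forcing set of the extended graph into
  one of \<open>G\<close>, which gives \<open>r\<close> as a lower bound; the new leaves at \<open>B\<close> attain it, because the
  reversal property leaves the vertices of \<open>B'\<close> free to force their own leaves at the end.
  Every vertex performs at most one force, and a leaf that is not initially blue performs none.
  So a minimum zero forcing set misses at most \<open>r\<close> of the \<open>2r\<close> leaves, that is, it consists of
  leaves only. Its contraction cannot meet both \<open>B\<close> and \<open>B'\<close>, so it is \<open>B\<close> or \<open>B'\<close>. The zero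
  forcing graph thus has exactly two vertices, which differ in \<open>2r > 2\<close> elements.
\<close>

section \<open>Color changes in an arbitrary graph\<close>

text \<open>The inclusion in \<open>{w}\<close> admits a \<open>w\<close> that is already blue,
  where zero steps suffice; this spares a case distinction at each use.\<close>

lemma color_change_into:
  assumes "u \<in> S" "neighbors G u - S \<subseteq> {w}" "w \<in> neighbors G u"
  shows "(color_change G)\<^sup>*\<^sup>* S (insert w S)"
proof (cases "w \<in> S")
  case True
  then show ?thesis by (simp add: insert_absorb)
next
  case False
  then have "color_change G S (insert w S)"
    using assms by (auto simp: color_change_def can_force_def)
  then show ?thesis by blast
qed

text \<open>Forces available at the same time do not obstruct one another: blue sets only grow, so a
  vertex able to force \<open>w\<close> from \<open>S\<close> still has no other white neighbor
  after earlier forces.\<close>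

lemma color_change_force_set:
  assumes "finite W"
    and "\<And>w. w \<in> W \<Longrightarrow> \<exists>u \<in> S. w \<in> neighbors G u \<and> neighbors G u - S \<subseteq> {w}"
  shows "(color_change G)\<^sup>*\<^sup>* S (S \<union> W)"
  using assms
proof (induction W)
  case empty
  then show ?case by simp
next
  case (insert w W)
  obtain u where "u \<in> S" "w \<in> neighbors G u" "neighbors G u - S \<subseteq> {w}"
    using insert.prems[of w] by auto
  then have "(color_change G)\<^sup>*\<^sup>* (S \<union> W) (insert w (S \<union> W))"
    by (intro color_change_into[of u]) auto
  with insert show ?case by (simp add: rtranclp_trans)
qed

lemma color_change_subset_verts:
  assumes "pair_wf_digraph G" "(color_change G)\<^sup>*\<^sup>* S T" "S \<subseteq> pverts G"
  shows "T \<subseteq> pverts G"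
  using assms(2)
proof (induction rule: rtranclp_induct)
  case base
  then show ?case using assms(3) .
next
  case (step X Y)
  interpret pair_wf_digraph G by fact
  show ?case
    using step by (auto simp: color_change_def can_force_def neighbors_def dest: in_arcsD2)
qed

lemma zero_forcing_number_le:
  "zero_forcing_set G S \<Longrightarrow> zero_forcing_number G \<le> card S"
  unfolding zero_forcing_number_def by (rule Least_le) blast

section \<open>Counting forces against white leaves\<close>

text \<open>In the proof, \<open>F\<close> is the set of vertices that have performed a force.\<close>

lemma card_white_leaves_le:
  assumes "pair_graph H" "zero_forcing_set H S" "L \<subseteq> pverts H" "L \<inter> S = {}"
    and leaf: "\<And>v. v \<in> L \<Longrightarrow> \<exists>u. neighbors H v = {u}"
  shows "card L \<le> card S"
proof -
  interpret pair_graph H by fact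
  have sym: "w \<in> neighbors H u \<longleftrightarrow> u \<in> neighbors H w" for u w
    using arcs_symmetric by (auto simp: neighbors_def)
  have S: "S \<subseteq> pverts H" "finite S"
    using assms(2) finite_subset[OF _ pair_finite_verts] by (auto simp: zero_forcing_set_def)
  \<comment> \<open>A leaf in \<open>L\<close> starts white and can be colored only by its sole
    neighbor, so once blue it has no white neighbor and never forces. Each force adds one vertex to
    \<open>F\<close> and one to \<open>X\<close>, hence the equation between cardinalities.\<close>
  have inv: "X \<subseteq> pverts H \<and> (\<forall>v \<in> L \<inter> X. neighbors H v \<subseteq> X)
      \<and> (\<exists>F. F \<subseteq> X - L \<and> card X = card S + card F \<and> (\<forall>u \<in> F. neighbors H u \<subseteq> X))"
    if "(color_change H)\<^sup>*\<^sup>* S X" for X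
    using that
  proof (induction rule: rtranclp_induct)
    case base
    show ?case using S assms(4) by (auto intro!: exI[of _ "{}"])
  next
    case (step X Y)
    then obtain F where X: "X \<subseteq> pverts H" "\<forall>v \<in> L \<inter> X. neighbors H v \<subseteq> X"
      and F: "F \<subseteq> X - L" "card X = card S + card F" "\<forall>u \<in> F. neighbors H u \<subseteq> X"
      by blast
    from step obtain u w where u: "u \<in> X" "neighbors H u - X = {w}" and Y: "Y = insert w X"
      by (auto simp: color_change_def can_force_def)
    have w: "w \<in> neighbors H u" "w \<notin> X" using u by auto
    have fin: "finite X" using X(1) pair_finite_verts finite_subset by blast
    have "finite F" using F(1) fin finite_subset by blast
    \<comment> \<open>The vertex \<open>w\<close> is a white neighbor of \<open>u\<close>, whereas
      members of \<open>F\<close> and blue members of \<open>L\<close> have no white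
      neighbor.\<close>
    have uF: "u \<notin> F" "u \<notin> L" using F(3) X(2) u(1) w by blast+
    have "w \<in> pverts H" using w by (auto simp: neighbors_def dest: in_arcsD2)
    moreover have "neighbors H v \<subseteq> Y" if "v \<in> L \<inter> Y" for v
    proof (cases "v = w")
      case True
      with that leaf[of v] w sym[of w u] u show ?thesis by (auto simp: Y)
    next
      case False
      with that X(2) show ?thesis by (auto simp: Y)
    qed
    moreover have "insert u F \<subseteq> Y - L" "\<forall>v \<in> insert u F. neighbors H v \<subseteq> Y"
      using F u uF by (auto simp: Y)
    moreover have "card Y = card S + card (insert u F)"
      using F(2) w fin \<open>finite F\<close> uF by (simp add: Y)
    ultimately show ?case using X(1) Y by blast
  qed
  have "(color_change H)\<^sup>*\<^sup>* S (pverts H)"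
    using assms(2) by (simp add: zero_forcing_set_def)
  from inv[OF this] obtain F where F: "F \<subseteq> pverts H - L" "card (pverts H) = card S + card F"
    by blast
  \<comment> \<open>All vertices are now blue, so \<open>card (pverts H) - card S\<close> of them
    have forced, and none of these lies in \<open>L\<close>.\<close>
  have "card F \<le> card (pverts H - L)"
    using F(1) pair_finite_verts by (intro card_mono) auto
  also have "\<dots> = card (pverts H) - card L"
    using assms(3) finite_subset[OF _ pair_finite_verts] by (intro card_Diff_subset)
  finally show ?thesis
    using F(2) card_mono[OF pair_finite_verts assms(3)] by simp
qed

section \<open>Contraction of the new leaves\<close>

lemma neighbors_attach_leaves_Inl:
  "neighbors (attach_leaves G U) (Inl v) =
    Inl ` neighbors G v \<union> (if v \<in> U then {Inr v} else {})"
  by (auto simp: neighbors_def attach_leaves_def)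

lemma neighbors_attach_leaves_Inr:
  "neighbors (attach_leaves G U) (Inr v) = (if v \<in> U then {Inl v} else {})"
  by (auto simp: neighbors_def attach_leaves_def)

definition contract_leaves :: "('a + 'a) \<Rightarrow> 'a" where
  "contract_leaves = case_sum id id"

lemma contract_leaves_simps [simp]:
  "contract_leaves (Inl v) = v" "contract_leaves (Inr v) = v"
  by (simp_all add: contract_leaves_def)

text \<open>A force along a leaf edge has both ends contracted to the same vertex, so nothing has to
  be done for it. A force along an edge of \<open>G\<close> can be repeated after contraction,
  unless its target is already blue there.\<close>

lemma zero_forcing_set_contract_leaves:
  assumes "pair_graph G" "U \<subseteq> pverts G" "zero_forcing_set (attach_leaves G U) S"
  shows "zero_forcing_set G (contract_leaves ` S)"
proof -
  interpret pair_graph G by fact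
  let ?H = "attach_leaves G U"
  have S: "S \<subseteq> pverts ?H" using assms(3) by (simp add: zero_forcing_set_def)
  have sub: "contract_leaves ` S \<subseteq> pverts G"
    using S assms(2) by (force simp: attach_leaves_def)
  have inv: "\<exists>Y. (color_change G)\<^sup>*\<^sup>* (contract_leaves ` S) Y \<and> contract_leaves ` X \<subseteq> Y"
    if "(color_change ?H)\<^sup>*\<^sup>* S X" for X
    using that
  proof (induction rule: rtranclp_induct)
    case base
    then show ?case by blast
  next
    case (step X X')
    then obtain Y where Y: "(color_change G)\<^sup>*\<^sup>* (contract_leaves ` S) Y"
      "contract_leaves ` X \<subseteq> Y" by blast
    from step obtain u w where u: "u \<in> X" "neighbors ?H u - X = {w}" and X': "X' = insert w X"
      by (auto simp: color_change_def can_force_def)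
    have uY: "contract_leaves u \<in> Y" using u Y by auto
    show ?case
    proof (cases "contract_leaves w \<in> Y")
      case True
      then show ?thesis using Y X' by auto
    next
      case False
      \<comment> \<open>Distinct contractions rule out a leaf edge, so \<open>u\<close> and
        \<open>w\<close> both come from vertices of \<open>G\<close>.\<close>
      then have ne: "contract_leaves w \<noteq> contract_leaves u" using uY by auto
      have w: "w \<in> neighbors ?H u" using u by blast
      obtain a where a: "u = Inl a"
      proof (cases u)
        case (Inr a)
        then show ?thesis
          using w ne by (simp add: neighbors_attach_leaves_Inr split: if_splits)
      qed (use that in blast)
      from w obtain b where b: "w = Inl b" "b \<in> neighbors G a"
        using ne a by (auto simp: neighbors_attach_leaves_Inl split: if_splits)
      have "neighbors G a - Y \<subseteq> {b}"
      proof
        \<comment> \<open>A vertex outside \<open>Y\<close> is white in \<open>X\<close> too, so a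
          white neighbor of \<open>a\<close> yields a white neighbor of \<open>u\<close>, and
          \<open>u\<close> has only \<open>w\<close>.\<close>
        fix c assume c: "c \<in> neighbors G a - Y"
        then have "Inl c \<notin> X" using Y(2) by force
        then have "Inl c \<in> neighbors ?H u - X"
          using c a by (auto simp: neighbors_attach_leaves_Inl)
        then show "c \<in> {b}" using u b by auto
      qed
      then have "(color_change G)\<^sup>*\<^sup>* Y (insert b Y)"
        using uY a b by (intro color_change_into[of a]) auto
      then have "(color_change G)\<^sup>*\<^sup>* (contract_leaves ` S) (insert b Y)"
        using Y(1) by (rule rtranclp_trans[rotated])
      moreover have "contract_leaves ` X' \<subseteq> insert b Y"
        using Y(2) X' b by auto
      ultimately show ?thesis by blast
    qed
  qed
  have "(color_change ?H)\<^sup>*\<^sup>* S (pverts ?H)"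
    using assms(3) by (simp add: zero_forcing_set_def)
  from inv[OF this] obtain Y where Y: "(color_change G)\<^sup>*\<^sup>* (contract_leaves ` S) Y"
    "contract_leaves ` pverts ?H \<subseteq> Y"
    by blast
  have "pverts G \<subseteq> Y"
    using Y(2) by (force simp: attach_leaves_def)
  moreover have "Y \<subseteq> pverts G"
    using pair_wf_digraph_axioms Y(1) sub by (rule color_change_subset_verts)
  ultimately show ?thesis using Y(1) sub by (simp add: zero_forcing_set_def)
qed

section \<open>Zero forcing from the new leaves at one set\<close>

text \<open>The added edges do not block the forces of \<open>G\<close>: a forcing vertex avoids
  \<open>B'\<close>, and if it lies in \<open>B\<close> its leaf is already blue.\<close>

lemma chronological_list_attach_leaves:
  assumes "chronological_list G S fs" "fst ` set fs \<inter> B' = {}"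
  shows "(color_change (attach_leaves G (B \<union> B')))\<^sup>*\<^sup>*
    (Inl ` S \<union> Inr ` B) (Inl ` pverts G \<union> Inr ` B)"
  using assms
proof (induction fs arbitrary: S)
  case Nil
  then show ?case by simp
next
  case (Cons f fs)
  obtain u w where f: "f = (u, w)" by (cases f)
  from Cons.prems f have u: "u \<in> S" "neighbors G u - S = {w}" "u \<notin> B'"
    by (auto simp: can_force_def)
  then have "w \<in> neighbors G u" by auto
  then have "(color_change (attach_leaves G (B \<union> B')))\<^sup>*\<^sup>* (Inl ` S \<union> Inr ` B)
      (insert (Inl w) (Inl ` S \<union> Inr ` B))"
    using u by (intro color_change_into[of "Inl u"]) (auto simp: neighbors_attach_leaves_Inl)
  moreover have "(color_change (attach_leaves G (B \<union> B')))\<^sup>*\<^sup>*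
      (Inl ` insert w S \<union> Inr ` B) (Inl ` pverts G \<union> Inr ` B)"
    using Cons.prems f by (intro Cons.IH) auto
  ultimately show ?case by (simp add: rtranclp_trans)
qed

text \<open>The leaves at \<open>B\<close> first force \<open>B\<close>, a chronological list
  witnessing the reversal is then replayed, and finally the vertices of \<open>B'\<close> force
  their leaves.\<close>

lemma zero_forcing_set_leaves_of_reversal:
  assumes "pair_graph G" "B \<subseteq> pverts G" "is_reversal G B B'"
  shows "zero_forcing_set (attach_leaves G (B \<union> B')) (Inr ` B)"
proof -
  interpret pair_graph G by fact
  let ?H = "attach_leaves G (B \<union> B')"
  obtain fs where fs: "chronological_list G B fs" and B': "B' = pverts G - fst ` set fs"
    using assms(3) by (auto simp: is_reversal_def)
  have fin: "finite B" "finite B'"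
    using assms(2) B' finite_subset[OF _ pair_finite_verts] by auto
  have "(color_change ?H)\<^sup>*\<^sup>* (Inr ` B) (Inr ` B \<union> Inl ` B)"
    using fin by (intro color_change_force_set) (auto simp: neighbors_attach_leaves_Inr)
  also have "Inr ` B \<union> Inl ` B = Inl ` B \<union> Inr ` B" by (rule Un_commute)
  also have "(color_change ?H)\<^sup>*\<^sup>* (Inl ` B \<union> Inr ` B) (Inl ` pverts G \<union> Inr ` B)"
    using fs B' by (intro chronological_list_attach_leaves) auto
  also have "(color_change ?H)\<^sup>*\<^sup>* (Inl ` pverts G \<union> Inr ` B)
      ((Inl ` pverts G \<union> Inr ` B) \<union> Inr ` B')"
  proof (intro color_change_force_set)
    fix w :: "'a + 'a" assume "w \<in> Inr ` B'"
    then obtain v where v: "w = Inr v" "v \<in> B'" by auto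
    \<comment> \<open>All neighbors of \<open>v\<close> inside \<open>G\<close> are blue by now, so
      only its own leaf can be white.\<close>
    have "neighbors G v \<subseteq> pverts G" by (auto simp: neighbors_def dest: in_arcsD2)
    with v B' show "\<exists>u \<in> Inl ` pverts G \<union> Inr ` B. w \<in> neighbors ?H u
        \<and> neighbors ?H u - (Inl ` pverts G \<union> Inr ` B) \<subseteq> {w}"
      by (intro bexI[of _ "Inl v"]) (auto simp: neighbors_attach_leaves_Inl)
  qed (use fin in simp)
  also have "(Inl ` pverts G \<union> Inr ` B) \<union> Inr ` B' = pverts ?H"
    by (auto simp: attach_leaves_def)
  finally show ?thesis
    by (auto simp: zero_forcing_set_def attach_leaves_def)
qed

section \<open>Minimum zero forcing sets of the extended graph\<close>

lemma zero_forcing_number_le_attach_leaves: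
  assumes "pair_graph G" "U \<subseteq> pverts G" "zero_forcing_set (attach_leaves G U) S"
  shows "zero_forcing_number G \<le> card S"
proof -
  interpret pair_graph "attach_leaves G U"
    using assms by (intro pair_graph_attach_leaves)
  have "finite S"
    using assms(3) finite_subset[OF _ pair_finite_verts] by (auto simp: zero_forcing_set_def)
  then have "card (contract_leaves ` S) \<le> card S" by (rule card_image_le)
  moreover have "zero_forcing_number G \<le> card (contract_leaves ` S)"
    using assms by (intro zero_forcing_number_le zero_forcing_set_contract_leaves)
  ultimately show ?thesis by simp
qed

lemma zero_forcing_number_attach_leaves:
  assumes "pair_graph G" "min_zero_forcing_set G B" "B' \<subseteq> pverts G" "is_reversal G B B'"
  shows "zero_forcing_number (attach_leaves G (B \<union> B')) = zero_forcing_number G"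
    (is "zero_forcing_number ?H = _")
proof -
  have B: "B \<subseteq> pverts G" "card B = zero_forcing_number G"
    using assms(2) by (auto simp: min_zero_forcing_set_def zero_forcing_set_def)
  have A: "zero_forcing_set ?H (Inr ` B)"
    using assms B by (intro zero_forcing_set_leaves_of_reversal)
  show ?thesis
    unfolding zero_forcing_number_def[of ?H]
  proof (rule Least_equality)
    show "\<exists>C. zero_forcing_set ?H C \<and> card C = zero_forcing_number G"
      using A B by (auto simp: card_image)
  qed (use assms B in \<open>auto intro: zero_forcing_number_le_attach_leaves[of G "B \<union> B'"]\<close>)
qed

text \<open>At most \<open>card S\<close> leaves start white, and there are at least twice that many
  leaves. So at least \<open>card S\<close> leaves lie in \<open>S\<close>, which leaves no room for
  other vertices.\<close>

lemma min_zero_forcing_set_attach_leaves: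
  assumes G: "pair_graph G" and U: "U \<subseteq> pverts G"
    and Z: "zero_forcing_number (attach_leaves G U) = zero_forcing_number G"
    and card_U: "card U \<ge> 2 * zero_forcing_number G"
    and S: "min_zero_forcing_set (attach_leaves G U) S"
  obtains C where "S = Inr ` C" "C \<subseteq> U" "min_zero_forcing_set G C"
proof -
  let ?H = "attach_leaves G U"
  have H: "pair_graph ?H" using G U by (rule pair_graph_attach_leaves)
  have zfs: "zero_forcing_set ?H S" and card_S: "card S = zero_forcing_number G"
    using S Z by (auto simp: min_zero_forcing_set_def)
  have sub: "S \<subseteq> pverts ?H" using zfs by (simp add: zero_forcing_set_def)
  interpret G: pair_graph G by fact
  interpret H: pair_graph ?H by fact
  have fin: "finite S" "finite U"
    using sub U H.pair_finite_verts G.pair_finite_verts finite_subset by blast+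
  let ?L = "Inr ` U :: ('a + 'a) set"
  have "card (?L - S) \<le> card S"
    using H zfs
  proof (rule card_white_leaves_le)
    show "?L - S \<subseteq> pverts ?H" by (auto simp: attach_leaves_def)
  qed (auto simp: neighbors_attach_leaves_Inr)
  moreover have "card (?L - S) = card U - card (?L \<inter> S)"
    using fin by (simp add: card_Diff_subset_Int card_image)
  ultimately have "card S \<le> card (?L \<inter> S)" using card_U card_S by simp
  then have "?L \<inter> S = S" using fin by (intro card_seteq) auto
  then obtain C where C: "S = Inr ` C" "C \<subseteq> U"
    by (metis inf.absorb_iff2 subset_image_iff)
  have "contract_leaves ` S = C" using C(1) by force
  then have "zero_forcing_set G C"
    using zero_forcing_set_contract_leaves[OF G U zfs] by simp
  moreover have "card C = zero_forcing_number G"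
    using C(1) card_S by (simp add: card_image)
  ultimately show ?thesis using that C by (simp add: min_zero_forcing_set_def)
qed

text \<open>A walk between distinct vertices would use an arc, but the symmetric closure of an empty
  arc set is empty.\<close>

lemma not_connected_no_arcs:
  assumes "parcs G = {}" "u \<in> pverts G" "v \<in> pverts G" "u \<noteq> v"
  shows "\<not> connected (with_proj G)"
proof
  assume "connected (with_proj G)"
  then have "u \<rightarrow>\<^sup>*\<^bsub>with_proj (mk_symmetric (with_proj G))\<^esub> v"
    using assms by (auto simp: connected_def strongly_connected_def)
  then show False
    using assms by (auto simp: reachable_def mk_symmetric_def elim: rtrancl_on.cases)
qed

theorem proposition3p2:
  fixes G :: "'a pair_pre_digraph" and B B' :: "'a set" and r :: nat
  assumes "pair_graph G"
    and "zero_forcing_number G = r"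
    and "r \<ge> 2"
    and "min_zero_forcing_set G B"
    and "min_zero_forcing_set G B'"
    and "B \<inter> B' = {}"
    and "is_reversal G B B'"
    and "is_reversal G B' B"
    and "\<not> (\<exists>C. min_zero_forcing_set G C \<and> C \<inter> B \<noteq> {} \<and> C \<inter> B' \<noteq> {})"
  shows "zero_forcing_number (attach_leaves G (B \<union> B')) = r
    \<and> \<not> connected (with_proj (zero_forcing_graph (attach_leaves G (B \<union> B'))))"
proof -
  interpret pair_graph G by fact
  let ?H = "attach_leaves G (B \<union> B')"
  have B: "B \<subseteq> pverts G" "card B = r" and B': "B' \<subseteq> pverts G" "card B' = r"
    using assms(2,4,5) by (auto simp: min_zero_forcing_set_def zero_forcing_set_def)
  have fin: "finite B" "finite B'"
    using B(1) B'(1) pair_finite_verts finite_subset by blast+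
  have card_U: "card (B \<union> B') = 2 * r"
    using fin B B' assms(6) by (simp add: card_Un_disjoint)
  have Z: "zero_forcing_number ?H = r"
    using zero_forcing_number_attach_leaves[OF assms(1,4) B'(1) assms(7)] assms(2) by simp
  have mzB: "min_zero_forcing_set ?H (Inr ` B)"
    using zero_forcing_set_leaves_of_reversal[OF assms(1) B(1) assms(7)] B(2) Z
    by (simp add: min_zero_forcing_set_def card_image)
  \<comment> \<open>Here the reversal in the other direction enters, with the roles of
    \<open>B\<close> and \<open>B'\<close> exchanged.\<close>
  have mzB': "min_zero_forcing_set ?H (Inr ` B')"
    using zero_forcing_set_leaves_of_reversal[OF assms(1) B'(1) assms(8)] B'(2) Z
    by (simp add: min_zero_forcing_set_def card_image Un_commute)
  have only: "S = Inr ` B \<or> S = Inr ` B'" if S: "min_zero_forcing_set ?H S" for S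
  proof -
    obtain C where C: "S = Inr ` C" "C \<subseteq> B \<union> B'" "min_zero_forcing_set G C"
    proof (rule min_zero_forcing_set_attach_leaves[of G "B \<union> B'" S])
      show "zero_forcing_number ?H = zero_forcing_number G" using Z assms(2) by simp
    qed (use assms(1,2) B B' card_U S in auto)
    have "card C = r" using C(3) assms(2) by (simp add: min_zero_forcing_set_def)
    \<comment> \<open>No minimum zero forcing set of \<open>G\<close> meets both sets; equal
      cardinality then turns the inclusion into an equality.\<close>
    moreover have "C \<subseteq> B \<or> C \<subseteq> B'" using C assms(9) by blast
    ultimately have "C = B \<or> C = B'"
      using fin B(2) B'(2) by (metis card_subset_eq)
    then show ?thesis using C(1) by blast
  qed
  \<comment> \<open>Equality would make the disjoint sets empty, against
    \<open>r \<ge> 2\<close>.\<close>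
  have "B \<noteq> B'" using B(2) assms(3,6) by auto
  then have ne: "Inr ` B \<noteq> (Inr ` B' :: ('a + 'a) set)"
    by (simp add: inj_image_eq_iff)
  have "(Inr ` B - Inr ` B') \<union> (Inr ` B' - Inr ` B) = (Inr ` (B \<union> B') :: ('a + 'a) set)"
    using assms(6) by auto
  then have "card ((Inr ` B - Inr ` B') \<union> (Inr ` B' - Inr ` B) :: ('a + 'a) set) = 2 * r"
    using card_U by (simp add: card_image)
  \<comment> \<open>The symmetric difference has size 0 if the two sets coincide and
    \<open>2 * r\<close>, at least 4, otherwise.\<close>
  then have "card ((S - S') \<union> (S' - S)) \<noteq> 2"
    if "min_zero_forcing_set ?H S" "min_zero_forcing_set ?H S'" for S S'
    using only[OF that(1)] only[OF that(2)] assms(3)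
    by (elim disjE) (simp_all add: Un_commute)
  then have "parcs (zero_forcing_graph ?H) = {}"
    by (auto simp: zero_forcing_graph_def)
  then have "\<not> connected (with_proj (zero_forcing_graph ?H))"
  proof (rule not_connected_no_arcs)
    show "Inr ` B \<in> pverts (zero_forcing_graph ?H)" "Inr ` B' \<in> pverts (zero_forcing_graph ?H)"
      using mzB mzB' by (simp_all add: zero_forcing_graph_def)
  qed (rule ne)
  with Z show ?thesis ..
qed

end
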